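(* The following limit relations hold for any $n\in\mathbb{N}_0$, where $N$ is a non-negative integer. (1) Racah $\to$ Hahn: $$\lim_{\delta\to\infty}R_n(\lambda(x);\alpha,\beta,-N-1,\delta)=h_n^{\alpha,\beta}(x;N),$$ $$\lim_{\gamma\to\infty}R_n(\lambda(x);\alpha,\beta,\gamma,-\beta-N-1)=h_n^{\alpha,\beta}(x;N),$$ $$\lim_{\delta\to\infty}R_n(\lambda(x);-N-1,\beta+\gamma+N+1,\gamma,\delta)=h_n^{\gamma,\beta}(x;N).$$ (2) Racah $\to$ dual Hahn: $$\lim_{\beta\to\infty}R_n(\lambda(x);-N-1,\beta,\gamma,\delta)=R_n(\lambda(x);\gamma,\delta,N),$$ $$\lim_{\alpha\to\infty}R_n(\lambda(x);\alpha,-\delta-N-1,\gamma,\delta)=R_n(\lambda(x);\gamma,\delta,N),$$ $$\lim_{\beta\to\infty}R_n(\lambda(x);\alpha,\beta,-N-1,\alpha+\delta+N+1)=R_n(\lambda(x);\alpha,\delta,N).$$ (3) Hahn $\to$ Krawtchouk: $$\lim_{t\to\infty}h_n^{(1-p)t,\,pt}(x;N)=K_n(x;p,N).$$ (4) Dual Hahn $\to$ Krawtchouk: $$\lim_{t\to\infty}R_n(\lambda(x);pt,(1-p)t,N)=K_n(x;p,N).$$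
   Context: $\mathbb{N}_0=\{0,1,2,\dots\}$; $(a)_0=1$, $(a)_n=a(a+1)\cdots(a+n-1)$. The following polynomials are given by their hypergeometric representations, reduced so as to be valid for all $n\ge0$. Racah (four parameters after the variable), with third and fourth parameters $\gamma,\delta$ and $\lambda(x)=x(x+\gamma+\delta+1)$: $$R_n(\lambda(x);\alpha,\beta,\gamma,\delta)=\frac{1}{(n+\alpha+\beta+1)_n}\sum_{k=0}^n\frac{(-n)_k(n+\alpha+\beta+1)_k(-x)_k(x+\gamma+\delta+1)_k}{k!}(\alpha+1+k)_{n-k}(\beta+\delta+1+k)_{n-k}(\gamma+1+k)_{n-k}.$$ Dual Hahn (three parameters after the variable), with first two parameters $\gamma,\delta$ and $\lambda(x)=x(x+\gamma+\delta+1)$: $$R_n(\lambda(x);\gamma,\delta,N)=\sum_{k=0}^n\frac{(-n)_k(-x)_k(x+\gamma+\delta+1)_k}{k!}(\gamma+1+k)_{n-k}(-N+k)_{n-k}.$$ Hahn: $$h_n^{\alpha,\beta}(x;N)=\frac{1}{(\alpha+\beta+n+1)_n}\sum_{k=0}^n\frac{(-n)_k(\alpha+\beta+n+1)_k(-x)_k}{k!}(-N+k)_{n-k}(\alpha+1+k)_{n-k}.$$ Krawtchouk ($p\in\mathbb{C}$, $p\neq0,1$): $$K_n(x;p,N)=\sum_{k=0}^n\frac{(-n)_k(-x)_k}{k!}(-N+k)_{n-k}\,p^{n-k}.$$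
   Formalization: In (1) the Racah polynomials are divided by the n-th power of the parameter tending to infinity (δ, γ, δ), in (4) the dual Hahn polynomial by t^n, and in (3) the Hahn superscripts are exchanged to pt, (1−p)t; as printed, these limits already fail for n=1. *)

theory Defs
  imports "HOL-Analysis.Analysis"
begin

text \<open>Racah and dual Hahn polynomials are polynomials in
  \<open>\<lambda>(x) = x (x + \<gamma> + \<delta> + 1)\<close>; they are written as functions of \<open>x\<close>, so
  \<open>racah n x \<alpha> \<beta> \<gamma> \<delta>\<close> stands for \<open>R\<^sub>n(\<lambda>(x); \<alpha>, \<beta>, \<gamma>, \<delta>)\<close>.\<close>

definition racah ::
  "nat \<Rightarrow> complex \<Rightarrow> complex \<Rightarrow> complex \<Rightarrow> complex \<Rightarrow> complex \<Rightarrow> complex" where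
  "racah n x \<alpha> \<beta> \<gamma> \<delta> =
     1 / pochhammer (of_nat n + \<alpha> + \<beta> + 1) n *
     (\<Sum>k=0..n. pochhammer (- of_nat n) k * pochhammer (of_nat n + \<alpha> + \<beta> + 1) k *
        pochhammer (- x) k * pochhammer (x + \<gamma> + \<delta> + 1) k / fact k *
        pochhammer (\<alpha> + 1 + of_nat k) (n - k) *
        pochhammer (\<beta> + \<delta> + 1 + of_nat k) (n - k) *
        pochhammer (\<gamma> + 1 + of_nat k) (n - k))"

definition dual_hahn ::
  "nat \<Rightarrow> complex \<Rightarrow> complex \<Rightarrow> complex \<Rightarrow> nat \<Rightarrow> complex" where
  "dual_hahn n x \<gamma> \<delta> N =
     (\<Sum>k=0..n. pochhammer (- of_nat n) k * pochhammer (- x) k *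
        pochhammer (x + \<gamma> + \<delta> + 1) k / fact k *
        pochhammer (\<gamma> + 1 + of_nat k) (n - k) *
        pochhammer (- of_nat N + of_nat k) (n - k))"

definition hahn ::
  "nat \<Rightarrow> complex \<Rightarrow> complex \<Rightarrow> complex \<Rightarrow> nat \<Rightarrow> complex" where
  "hahn n \<alpha> \<beta> x N =
     1 / pochhammer (\<alpha> + \<beta> + of_nat n + 1) n *
     (\<Sum>k=0..n. pochhammer (- of_nat n) k * pochhammer (\<alpha> + \<beta> + of_nat n + 1) k *
        pochhammer (- x) k / fact k *
        pochhammer (- of_nat N + of_nat k) (n - k) *
        pochhammer (\<alpha> + 1 + of_nat k) (n - k))"

definition krawtchouk :: "nat \<Rightarrow> complex \<Rightarrow> complex \<Rightarrow> nat \<Rightarrow> complex" where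
  "krawtchouk n x p N =
     (\<Sum>k=0..n. pochhammer (- of_nat n) k * pochhammer (- x) k / fact k *
        pochhammer (- of_nat N + of_nat k) (n - k) * p ^ (n - k))"

text \<open>The normalisation above is monic in \<open>\<lambda>(x)\<close> (Racah, dual Hahn) resp. in \<open>x\<close>
  (Hahn, Krawtchouk). When \<open>\<delta>\<close> or \<open>\<gamma>\<close> is sent to infinity, \<open>\<lambda>(x)\<close> grows like
  \<open>\<delta> x\<close> resp. \<open>\<gamma> x\<close>, so the limits Racah to Hahn and dual Hahn to Krawtchouk need
  division by the \<open>n\<close>-th power of the parameter. Also, with the first superscript of Hahn
  entering through \<open>\<alpha> + 1 + k\<close>, the superscripts leading to \<open>K\<^sub>n(x; p, N)\<close> are \<open>p t, (1 - p) t\<close>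
  in this order. The following instances show that the limits without these two
  adjustments fail.\<close>

lemma not_tendsto_affine_at_infinity:
  fixes c l :: complex
  shows "\<not> ((\<lambda>t. t + c) \<longlongrightarrow> l) at_infinity"
proof
  assume "((\<lambda>t. t + c) \<longlongrightarrow> l) at_infinity"
  then have "((\<lambda>t. t + c - c) \<longlongrightarrow> l - c) at_infinity"
    by (intro tendsto_intros)
  then have "((\<lambda>t::complex. t) \<longlongrightarrow> l - c) at_infinity" by simp
  moreover have "filterlim (\<lambda>t::complex. t) at_infinity at_infinity"
    by (rule filterlim_ident)
  ultimately show False
    using not_tendsto_and_filterlim_at_infinity trivial_limit_at_infinity by blast
qed

lemma racah_hahn_unscaled_fails:
  "\<not> ((\<lambda>\<delta>. racah 1 1 0 0 (- of_nat 0 - 1) \<delta>) \<longlongrightarrow> hahn 1 0 0 1 0) at_infinity"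
  "\<not> ((\<lambda>\<gamma>. racah 1 1 0 0 \<gamma> (- 0 - of_nat 0 - 1)) \<longlongrightarrow> hahn 1 0 0 1 0) at_infinity"
  "\<not> ((\<lambda>\<delta>. racah 1 1 (- of_nat 0 - 1) (0 + 0 + of_nat 0 + 1) 0 \<delta>) \<longlongrightarrow> hahn 1 0 0 1 0)
     at_infinity"
proof -
  have "racah 1 1 0 0 (- of_nat 0 - 1) t = t + 1"
    "racah 1 1 0 0 t (- 0 - of_nat 0 - 1) = t + 1"
    "racah 1 1 (- of_nat 0 - 1) (0 + 0 + of_nat 0 + 1) 0 t = t + 2" for t
    by (simp_all add: racah_def field_simps)
  then show
    "\<not> ((\<lambda>\<delta>. racah 1 1 0 0 (- of_nat 0 - 1) \<delta>) \<longlongrightarrow> hahn 1 0 0 1 0) at_infinity"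
    "\<not> ((\<lambda>\<gamma>. racah 1 1 0 0 \<gamma> (- 0 - of_nat 0 - 1)) \<longlongrightarrow> hahn 1 0 0 1 0) at_infinity"
    "\<not> ((\<lambda>\<delta>. racah 1 1 (- of_nat 0 - 1) (0 + 0 + of_nat 0 + 1) 0 \<delta>) \<longlongrightarrow> hahn 1 0 0 1 0)
       at_infinity"
    using not_tendsto_affine_at_infinity by presburger+
qed

lemma dual_hahn_krawtchouk_unscaled_fails:
  assumes "p \<noteq> 0" "p \<noteq> 1"
  shows "\<not> ((\<lambda>t. dual_hahn 1 1 (p * t) ((1 - p) * t) 0) \<longlongrightarrow> krawtchouk 1 1 p 0) at_infinity"
proof -
  have "dual_hahn 1 1 (p * t) ((1 - p) * t) 0 = t + 2" for t
    by (simp add: dual_hahn_def algebra_simps)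
  then show ?thesis using not_tendsto_affine_at_infinity[of 2] by simp
qed

lemma hahn_krawtchouk_swapped_fails:
  "\<not> ((\<lambda>t. hahn 1 ((1 - 2) * t) (2 * t) 0 1) \<longlongrightarrow> krawtchouk 1 0 2 1) at_infinity"
proof
  assume "((\<lambda>t. hahn 1 ((1 - 2) * t) (2 * t) 0 1) \<longlongrightarrow> krawtchouk 1 0 2 1) at_infinity"
  moreover have "hahn 1 ((1 - 2) * t) (2 * t) 0 1 = (t - 1) / (t + 2)" for t
    by (simp add: hahn_def algebra_simps divide_simps)
  moreover have "krawtchouk 1 0 2 1 = -2"
    by (simp add: krawtchouk_def)
  ultimately have lim: "((\<lambda>t::complex. (t - 1) / (t + 2)) \<longlongrightarrow> -2) at_infinity"
    by simp
  have "((\<lambda>t::complex. 3 / (t + 2)) \<longlongrightarrow> 0) at_infinity"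
    by (rule tendsto_divide_0[OF tendsto_const
          tendsto_add_filterlim_at_infinity'[OF filterlim_ident tendsto_const]])
  then have "((\<lambda>t::complex. (t - 1) / (t + 2) + 3 / (t + 2)) \<longlongrightarrow> -2 + 0) at_infinity"
    by (intro tendsto_add lim)
  moreover have "eventually (\<lambda>t::complex. (t - 1) / (t + 2) + 3 / (t + 2) = 1) at_infinity"
    unfolding eventually_at_infinity
  proof (intro exI allI impI)
    fix t :: complex assume "3 \<le> norm t"
    then have "t + 2 \<noteq> 0" by (auto simp: add_eq_0_iff2)
    then show "(t - 1) / (t + 2) + 3 / (t + 2) = 1" by (simp add: divide_simps)
  qed
  ultimately have "((\<lambda>t::complex. 1::complex) \<longlongrightarrow> -2 + 0) at_infinity"
    by (rule Lim_transform_eventually)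
  then show False
    by (simp add: tendsto_const_iff trivial_limit_at_infinity)
qed

end

theory Submission
  imports Defs
begin

text \<open>In every limit exactly two kinds of factors in the \<open>k\<close>-th summand depend on the parameter \<open>t\<close>
  sent to infinity: a Pochhammer symbol of length \<open>k\<close> with argument \<open>t + b\<close> and one of length
  \<open>n - k\<close> with argument \<open>q t + d + k\<close>. Together they grow like \<open>q\<^sup>n\<^sup>-\<^sup>k t\<^sup>n\<close>, which is compensated
  by \<open>t\<^sup>n\<close> or by the normalising Pochhammer symbol of length \<open>n\<close>.\<close>

lemma pochhammer_affine_over_power_tendsto:
  fixes q d :: complex
  shows "((\<lambda>t. pochhammer (q * t + d) m / t ^ m) \<longlongrightarrow> q ^ m) at_infinity"
proof (induction m)
  case (Suc m)
  \<comment> \<open>The last Pochhammer factor over one power of \<open>t\<close> is a constant plus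
    a multiple of \<open>1 / t\<close>, away from \<open>t = 0\<close>.\<close>
  have "((\<lambda>t. q + (d + of_nat m) / t) \<longlongrightarrow> q + 0) at_infinity"
    by (intro tendsto_intros tendsto_divide_0[OF tendsto_const filterlim_ident])
  moreover have "eventually (\<lambda>t. q + (d + of_nat m) / t = (q * t + d + of_nat m) / t) at_infinity"
    using eventually_not_equal_at_infinity[of 0] by eventually_elim (simp add: field_simps)
  ultimately have "((\<lambda>t. (q * t + d + of_nat m) / t) \<longlongrightarrow> q) at_infinity"
    using Lim_transform_eventually by fastforce
  then have "((\<lambda>t. (pochhammer (q * t + d) m / t ^ m) * ((q * t + d + of_nat m) / t))
      \<longlongrightarrow> q ^ m * q) at_infinity"
    by (intro tendsto_mult Suc.IH)
  then show ?case by (simp add: pochhammer_Suc mult_ac)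
qed simp

text \<open>Each summand absorbs \<open>t ^ n\<close> exactly, since the two Pochhammer lengths add
  up to \<open>n\<close>. \<open>C\<close> collects all factors free of \<open>t\<close>. This
  serves the limits whose statement divides by the \<open>n\<close>-th power of the
  parameter.\<close>

lemma sum_pochhammer_over_power_tendsto:
  fixes b d q :: complex and C :: "nat \<Rightarrow> complex"
  shows "((\<lambda>t. (\<Sum>k=0..n. C k * pochhammer (t + b) k *
            pochhammer (q * t + d + of_nat k) (n - k)) / t ^ n)
         \<longlongrightarrow> (\<Sum>k=0..n. C k * q ^ (n - k))) at_infinity"
proof -
  have "((\<lambda>t. \<Sum>k=0..n. C k * (pochhammer (1 * t + b) k / t ^ k) *
            (pochhammer (q * t + (d + of_nat k)) (n - k) / t ^ (n - k)))
         \<longlongrightarrow> (\<Sum>k=0..n. C k * 1 ^ k * q ^ (n - k))) at_infinity"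
    by (intro tendsto_sum tendsto_mult tendsto_const pochhammer_affine_over_power_tendsto)
  moreover have "(\<Sum>k=0..n. C k * (pochhammer (1 * t + b) k / t ^ k) *
            (pochhammer (q * t + (d + of_nat k)) (n - k) / t ^ (n - k))) =
        (\<Sum>k=0..n. C k * pochhammer (t + b) k *
            pochhammer (q * t + d + of_nat k) (n - k)) / t ^ n" for t
    unfolding sum_divide_distrib
  proof (rule sum.cong)
    fix k assume "k \<in> {0..n}"
    \<comment> \<open>This also holds at \<open>t = 0\<close>, so the rearrangement is an identity
      for every \<open>t\<close>.\<close>
    then have "t ^ n = t ^ k * t ^ (n - k)" by (simp flip: power_add)
    then show "C k * (pochhammer (1 * t + b) k / t ^ k) *
            (pochhammer (q * t + (d + of_nat k)) (n - k) / t ^ (n - k)) =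
          C k * pochhammer (t + b) k * pochhammer (q * t + d + of_nat k) (n - k) / t ^ n"
      by (simp add: add.assoc)
  qed simp
  ultimately show ?thesis by simp
qed

text \<open>The normalising symbol is asymptotic to \<open>t ^ n\<close>, so it can replace that
  power. This serves the limits without explicit scaling.\<close>

lemma sum_pochhammer_over_pochhammer_tendsto:
  fixes b d e q :: complex and C :: "nat \<Rightarrow> complex"
  shows "((\<lambda>t. 1 / pochhammer (t + e) n * (\<Sum>k=0..n. C k * pochhammer (t + b) k *
            pochhammer (q * t + d + of_nat k) (n - k)))
         \<longlongrightarrow> (\<Sum>k=0..n. C k * q ^ (n - k))) at_infinity"
proof -
  let ?S = "\<lambda>t. \<Sum>k=0..n. C k * pochhammer (t + b) k *
            pochhammer (q * t + d + of_nat k) (n - k)"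
  have "((\<lambda>t. (?S t / t ^ n) / (pochhammer (1 * t + e) n / t ^ n))
      \<longlongrightarrow> (\<Sum>k=0..n. C k * q ^ (n - k)) / 1 ^ n) at_infinity"
    by (intro tendsto_divide sum_pochhammer_over_power_tendsto
        pochhammer_affine_over_power_tendsto) simp
  moreover have "eventually (\<lambda>t. (?S t / t ^ n) / (pochhammer (1 * t + e) n / t ^ n) =
      1 / pochhammer (t + e) n * ?S t) at_infinity"
    \<comment> \<open>Only \<open>t \<noteq> 0\<close> is required: at a zero of the normalising
      symbol both sides are 0, by division by zero.\<close>
    using eventually_not_equal_at_infinity[of 0] by eventually_elim simp
  ultimately show ?thesis
    using Lim_transform_eventually by fastforce
qed

theorem mainTheorem11:
  fixes n N :: nat and x \<alpha> \<beta> \<gamma> \<delta> p :: complex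
  assumes "p \<noteq> 0" and "p \<noteq> 1"
  shows
   "((\<lambda>\<delta>. racah n x \<alpha> \<beta> (- of_nat N - 1) \<delta> / \<delta> ^ n)
         \<longlongrightarrow> hahn n \<alpha> \<beta> x N) at_infinity \<and>
    ((\<lambda>\<gamma>. racah n x \<alpha> \<beta> \<gamma> (- \<beta> - of_nat N - 1) / \<gamma> ^ n)
         \<longlongrightarrow> hahn n \<alpha> \<beta> x N) at_infinity \<and>
    ((\<lambda>\<delta>. racah n x (- of_nat N - 1) (\<beta> + \<gamma> + of_nat N + 1) \<gamma> \<delta> / \<delta> ^ n)
         \<longlongrightarrow> hahn n \<gamma> \<beta> x N) at_infinity \<and>
    ((\<lambda>\<beta>. racah n x (- of_nat N - 1) \<beta> \<gamma> \<delta>)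
         \<longlongrightarrow> dual_hahn n x \<gamma> \<delta> N) at_infinity \<and>
    ((\<lambda>\<alpha>. racah n x \<alpha> (- \<delta> - of_nat N - 1) \<gamma> \<delta>)
         \<longlongrightarrow> dual_hahn n x \<gamma> \<delta> N) at_infinity \<and>
    ((\<lambda>\<beta>. racah n x \<alpha> \<beta> (- of_nat N - 1) (\<alpha> + \<delta> + of_nat N + 1))
         \<longlongrightarrow> dual_hahn n x \<alpha> \<delta> N) at_infinity \<and>
    ((\<lambda>t. hahn n (p * t) ((1 - p) * t) x N)
         \<longlongrightarrow> krawtchouk n x p N) at_infinity \<and>
    ((\<lambda>t. dual_hahn n x (p * t) ((1 - p) * t) N / t ^ n)
         \<longlongrightarrow> krawtchouk n x p N) at_infinity"
proof (intro conjI)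
  \<comment> \<open>In the three Racah to Hahn limits the normalising symbol is constant, and the
    growing symbol of length \<open>k\<close> comes from \<lambda>(x). The truncating parameter
    turns one symbol of length \<open>n - k\<close> into that of \<open>- N + k\<close>.\<close>
  show "((\<lambda>\<delta>. racah n x \<alpha> \<beta> (- of_nat N - 1) \<delta> / \<delta> ^ n) \<longlongrightarrow> hahn n \<alpha> \<beta> x N) at_infinity"
    using tendsto_mult[OF tendsto_const[of "1 / pochhammer (\<alpha> + \<beta> + of_nat n + 1) n"]
        sum_pochhammer_over_power_tendsto[where n = n and b = "x - of_nat N" and q = 1
        and d = "\<beta> + 1" and C = "\<lambda>k. pochhammer (- of_nat n) k * pochhammer (- x) k / fact k * pochhammer (\<alpha> + \<beta> + of_nat n + 1) k * pochhammer (- of_nat N + of_nat k) (n - k) * pochhammer (\<alpha> + 1 + of_nat k) (n - k)"]]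
    by (simp add: racah_def dual_hahn_def hahn_def krawtchouk_def algebra_simps)
next
  show "((\<lambda>\<gamma>. racah n x \<alpha> \<beta> \<gamma> (- \<beta> - of_nat N - 1) / \<gamma> ^ n) \<longlongrightarrow> hahn n \<alpha> \<beta> x N) at_infinity"
    using tendsto_mult[OF tendsto_const[of "1 / pochhammer (\<alpha> + \<beta> + of_nat n + 1) n"]
        sum_pochhammer_over_power_tendsto[where n = n and b = "x - \<beta> - of_nat N" and q = 1
        and d = "1" and C = "\<lambda>k. pochhammer (- of_nat n) k * pochhammer (- x) k / fact k * pochhammer (\<alpha> + \<beta> + of_nat n + 1) k * pochhammer (- of_nat N + of_nat k) (n - k) * pochhammer (\<alpha> + 1 + of_nat k) (n - k)"]]
    by (simp add: racah_def dual_hahn_def hahn_def krawtchouk_def algebra_simps)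
next
  \<comment> \<open>The first two Racah parameters add up to \<beta> + \<gamma>, as the Hahn
    normalisation demands.\<close>
  show "((\<lambda>\<delta>. racah n x (- of_nat N - 1) (\<beta> + \<gamma> + of_nat N + 1) \<gamma> \<delta> / \<delta> ^ n) \<longlongrightarrow> hahn n \<gamma> \<beta> x N) at_infinity"
    using tendsto_mult[OF tendsto_const[of "1 / pochhammer (\<gamma> + \<beta> + of_nat n + 1) n"]
        sum_pochhammer_over_power_tendsto[where n = n and b = "x + \<gamma> + 1" and q = 1
        and d = "\<beta> + \<gamma> + of_nat N + 2" and C = "\<lambda>k. pochhammer (- of_nat n) k * pochhammer (- x) k / fact k * pochhammer (\<gamma> + \<beta> + of_nat n + 1) k * pochhammer (- of_nat N + of_nat k) (n - k) * pochhammer (\<gamma> + 1 + of_nat k) (n - k)"]]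
    by (simp add: racah_def dual_hahn_def hahn_def krawtchouk_def algebra_simps)
next
  \<comment> \<open>In the three Racah to dual Hahn limits \<lambda>(x) stays fixed. The growing
    symbol of length \<open>k\<close> has the same argument as the normalising one, hence
    \<open>b = e\<close>.\<close>
  show "((\<lambda>\<beta>. racah n x (- of_nat N - 1) \<beta> \<gamma> \<delta>) \<longlongrightarrow> dual_hahn n x \<gamma> \<delta> N) at_infinity"
    using sum_pochhammer_over_pochhammer_tendsto[where n = n and b = "of_nat n - of_nat N" and e = "of_nat n - of_nat N" and q = 1
        and d = "\<delta> + 1" and C = "\<lambda>k. pochhammer (- of_nat n) k * pochhammer (- x) k / fact k * pochhammer (x + \<gamma> + \<delta> + 1) k * pochhammer (- of_nat N + of_nat k) (n - k) * pochhammer (\<gamma> + 1 + of_nat k) (n - k)"]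
    by (simp add: racah_def dual_hahn_def hahn_def krawtchouk_def algebra_simps)
next
  show "((\<lambda>\<alpha>. racah n x \<alpha> (- \<delta> - of_nat N - 1) \<gamma> \<delta>) \<longlongrightarrow> dual_hahn n x \<gamma> \<delta> N) at_infinity"
    using sum_pochhammer_over_pochhammer_tendsto[where n = n and b = "of_nat n - \<delta> - of_nat N" and e = "of_nat n - \<delta> - of_nat N" and q = 1
        and d = "1" and C = "\<lambda>k. pochhammer (- of_nat n) k * pochhammer (- x) k / fact k * pochhammer (x + \<gamma> + \<delta> + 1) k * pochhammer (- of_nat N + of_nat k) (n - k) * pochhammer (\<gamma> + 1 + of_nat k) (n - k)"]
    by (simp add: racah_def dual_hahn_def hahn_def krawtchouk_def algebra_simps)
next
  \<comment> \<open>The last two Racah parameters add up to \<alpha> + \<delta>, so \<lambda>(x) is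
    already that of the limit.\<close>
  show "((\<lambda>\<beta>. racah n x \<alpha> \<beta> (- of_nat N - 1) (\<alpha> + \<delta> + of_nat N + 1)) \<longlongrightarrow> dual_hahn n x \<alpha> \<delta> N) at_infinity"
    using sum_pochhammer_over_pochhammer_tendsto[where n = n and b = "of_nat n + \<alpha> + 1" and e = "of_nat n + \<alpha> + 1" and q = 1
        and d = "\<alpha> + \<delta> + of_nat N + 2" and C = "\<lambda>k. pochhammer (- of_nat n) k * pochhammer (- x) k / fact k * pochhammer (x + \<alpha> + \<delta> + 1) k * pochhammer (- of_nat N + of_nat k) (n - k) * pochhammer (\<alpha> + 1 + of_nat k) (n - k)"]
    by (simp add: racah_def dual_hahn_def hahn_def krawtchouk_def algebra_simps)
next
  \<comment> \<open>Here and in the last limit the two parameters add up to \<open>t\<close>, while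
    the first alone, \<open>p * t\<close>, enters the symbol of length \<open>n - k\<close>. Thus
    \<open>q = p\<close> yields the Krawtchouk power \<open>p ^ (n - k)\<close>.\<close>
  show "((\<lambda>t. hahn n (p * t) ((1 - p) * t) x N) \<longlongrightarrow> krawtchouk n x p N) at_infinity"
    using sum_pochhammer_over_pochhammer_tendsto[where n = n and b = "of_nat n + 1" and e = "of_nat n + 1" and q = p
        and d = "1" and C = "\<lambda>k. pochhammer (- of_nat n) k * pochhammer (- x) k / fact k * pochhammer (- of_nat N + of_nat k) (n - k)"]
    by (simp add: racah_def dual_hahn_def hahn_def krawtchouk_def algebra_simps)
next
  show "((\<lambda>t. dual_hahn n x (p * t) ((1 - p) * t) N / t ^ n) \<longlongrightarrow> krawtchouk n x p N) at_infinity"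
    using sum_pochhammer_over_power_tendsto[where n = n and b = "x + 1" and q = p
        and d = "1" and C = "\<lambda>k. pochhammer (- of_nat n) k * pochhammer (- x) k / fact k * pochhammer (- of_nat N + of_nat k) (n - k)"]
    by (simp add: racah_def dual_hahn_def hahn_def krawtchouk_def algebra_simps)
qed

end
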